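(* Let $\mathbf{S}_n^{(2,0)}(\rho)\in\mathbb{C}^{n\times n}$ ($n=2N_{\mathrm{mesh}}$) and $\mathbf{S}_n^{(3,0)}(\rho)\in\mathbb{C}^{n\times n}$ ($n=3N_{\mathrm{mesh}}$), $N_{\mathrm{mesh}}\ge 1$, be the matrices defined in the context. For every $\rho>0$, the condition numbers of $\mathbf{S}_n^{(2,0)}(\rho)$ and of $\mathbf{S}_n^{(3,0)}(\rho)$ grow at most polynomially as $n\to\infty$, i.e. there is a finite $\nu$ with $\kappa(\mathbf{S}_n^{(2,0)}(\rho))=O(n^\nu)$ and $\kappa(\mathbf{S}_n^{(3,0)}(\rho))=O(n^\nu)$.
   Context: For $p\in\{2,3\}$, $\mathbf{S}_n^{(p,0)}(\rho)=\mathrm{i}\mathbf{B}_n^{(p,0)}-\rho\,\mathbf{C}_n^{(p,0)}$ ($\mathrm{i}$ the imaginary unit), where $\mathbf{B}_n^{(p,0)}=(B_{i-j})_{i,j=0}^{N_{\mathrm{mesh}}-1}$ and $\mathbf{C}_n^{(p,0)}=(C_{i-j})_{i,j=0}^{N_{\mathrm{mesh}}-1}$ are block lower triangular block Toeplitz matrices with $p\times p$ blocks, all blocks other than those listed being zero. For $p=2$: $$B_0=\tfrac23\begin{pmatrix}-1&-1\\2&-1\end{pmatrix},\ B_1=\tfrac23\begin{pmatrix}-1&4\\0&-1\end{pmatrix},\ B_2=\tfrac23\begin{pmatrix}0&-1\\0&0\end{pmatrix},$$ $$C_0=\tfrac16\begin{pmatrix}2&1\\0&2\end{pmatrix},\ C_1=\tfrac16\begin{pmatrix}-2&0\\0&-2\end{pmatrix},\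 C_2=\tfrac16\begin{pmatrix}0&-1\\0&0\end{pmatrix}.$$ For $p=3$: $$B_0=\tfrac3{10}\begin{pmatrix}-3&-2&-1\\4&1&-2\\1&4&-3\end{pmatrix},\ B_1=\tfrac3{10}\begin{pmatrix}-2&-3&12\\0&0&-3\\0&0&-2\end{pmatrix},\ B_2=\tfrac3{10}\begin{pmatrix}0&0&-1\\0&0&0\\0&0&0\end{pmatrix},$$ $$C_0=\tfrac1{20}\begin{pmatrix}6&3&1\\0&3&3\\-3&0&6\end{pmatrix},\ C_1=\tfrac1{20}\begin{pmatrix}-3&-6&0\\0&0&-6\\0&0&-3\end{pmatrix},\ C_2=\tfrac1{20}\begin{pmatrix}0&0&-1\\0&0&0\\0&0&0\end{pmatrix}.$$ $\kappa(M)=\|M\|\,\|M^{-1}\|$ in the spectral norm, with $\kappa(M)=\infty$ if $M$ is singular. *)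

theory Defs
  imports
    "HOL-Library.Extended_Real"
    "HOL-Analysis.L2_Norm"
    "Jordan_Normal_Form.Gauss_Jordan_Elimination"
begin

(* p N x p N matrix whose (I, J) block, 0 <= I, J < N, is the p x p matrix A (I - J);
   the block index is an int since it is negative above the block diagonal. *)
definition block_toeplitz :: "nat \<Rightarrow> nat \<Rightarrow> (int \<Rightarrow> complex mat) \<Rightarrow> complex mat" where
  "block_toeplitz p N A =
     mat (p * N) (p * N)
       (\<lambda>(i, j). A (int (i div p) - int (j div p)) $$ (i mod p, j mod p))"

definition B2 :: "int \<Rightarrow> complex mat" where
  "B2 k =
     (if k = 0 then (2/3) \<cdot>\<^sub>m mat_of_rows_list 2 [[-1, -1], [2, -1]]
      else if k = 1 then (2/3) \<cdot>\<^sub>m mat_of_rows_list 2 [[-1, 4], [0, -1]]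
      else if k = 2 then (2/3) \<cdot>\<^sub>m mat_of_rows_list 2 [[0, -1], [0, 0]]
      else 0\<^sub>m 2 2)"

definition C2 :: "int \<Rightarrow> complex mat" where
  "C2 k =
     (if k = 0 then (1/6) \<cdot>\<^sub>m mat_of_rows_list 2 [[2, 1], [0, 2]]
      else if k = 1 then (1/6) \<cdot>\<^sub>m mat_of_rows_list 2 [[-2, 0], [0, -2]]
      else if k = 2 then (1/6) \<cdot>\<^sub>m mat_of_rows_list 2 [[0, -1], [0, 0]]
      else 0\<^sub>m 2 2)"

definition B3 :: "int \<Rightarrow> complex mat" where
  "B3 k =
     (if k = 0 then (3/10) \<cdot>\<^sub>m mat_of_rows_list 3 [[-3, -2, -1], [4, 1, -2], [1, 4, -3]]
      else if k = 1 then (3/10) \<cdot>\<^sub>m mat_of_rows_list 3 [[-2, -3, 12], [0, 0, -3], [0, 0, -2]]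
      else if k = 2 then (3/10) \<cdot>\<^sub>m mat_of_rows_list 3 [[0, 0, -1], [0, 0, 0], [0, 0, 0]]
      else 0\<^sub>m 3 3)"

definition C3 :: "int \<Rightarrow> complex mat" where
  "C3 k =
     (if k = 0 then (1/20) \<cdot>\<^sub>m mat_of_rows_list 3 [[6, 3, 1], [0, 3, 3], [-3, 0, 6]]
      else if k = 1 then (1/20) \<cdot>\<^sub>m mat_of_rows_list 3 [[-3, -6, 0], [0, 0, -6], [0, 0, -3]]
      else if k = 2 then (1/20) \<cdot>\<^sub>m mat_of_rows_list 3 [[0, 0, -1], [0, 0, 0], [0, 0, 0]]
      else 0\<^sub>m 3 3)"

(* The argument N is the number N_mesh of blocks, so S2 and S3 have sizes n = 2 N and n = 3 N. *)
definition S2 :: "nat \<Rightarrow> real \<Rightarrow> complex mat" where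
  "S2 N \<rho> = \<i> \<cdot>\<^sub>m block_toeplitz 2 N B2 - complex_of_real \<rho> \<cdot>\<^sub>m block_toeplitz 2 N C2"

definition S3 :: "nat \<Rightarrow> real \<Rightarrow> complex mat" where
  "S3 N \<rho> = \<i> \<cdot>\<^sub>m block_toeplitz 3 N B3 - complex_of_real \<rho> \<cdot>\<^sub>m block_toeplitz 3 N C3"

definition euclidean_norm :: "complex vec \<Rightarrow> real" where
  "euclidean_norm v = L2_set (\<lambda>i. cmod (v $ i)) {..<dim_vec v}"

(* The supremum is over a nonempty set that is bounded above, so the real-valued SUP is proper. *)
definition spectral_norm :: "complex mat \<Rightarrow> real" where
  "spectral_norm A =
     (SUP v \<in> {v \<in> carrier_vec (dim_col A). euclidean_norm v \<le> 1}. euclidean_norm (A *\<^sub>v v))"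

(* For a square matrix, mat_inverse returns None exactly when it is singular. *)
definition condition_number :: "complex mat \<Rightarrow> ereal" where
  "condition_number M =
     (case mat_inverse M of
        None \<Rightarrow> \<infinity>
      | Some M' \<Rightarrow> ereal (spectral_norm M * spectral_norm M'))"

end

theory Submission
  imports Defs
    "Jordan_Normal_Form.Determinant"
    "HOL-Computational_Algebra.Polynomial_FPS"
    "HOL-Computational_Algebra.Fundamental_Theorem_Algebra"
begin

text \<open>
  A block lower triangular block Toeplitz matrix is determined by its symbol, the \<open>p \<times> p\<close> matrix
  \<open>F\<close> of formal power series whose \<open>k\<close>-th coefficients form the \<open>k\<close>-th block. Because all blocks
  above the diagonal vanish, truncation to \<open>N\<close> block rows and columns commutes with
  multiplication: the product of two such matrices has the product symbol (\<open>toeplitz_mult\<close>). So the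
  inverse of the matrix is again block Toeplitz, with symbol \<open>(det F)\<^sup>-\<^sup>1 adj F\<close>, and its size is a
  question about the coefficients of \<open>1 / det F\<close>.

  The symbols in question are polynomial. If \<open>det F\<close> has no zero in the open unit disc, it is
  a constant times a product of factors \<open>1 - \<omega> z\<close> with \<open>\<bar>\<omega>\<bar> \<le> 1\<close>. Each factor has the
  geometric series as reciprocal, with coefficients bounded by 1, and a product of power series
  with polynomially bounded coefficients is again of this kind (\<open>poly_inverse_fps_growth\<close>).
  Hence all entries of the inverse are bounded by a power of \<open>N\<close>, and so are the spectral norms,
  which exceed the largest entry by at most a polynomial factor
  (\<open>condition_number_toeplitz_fps_of_poly\<close>).

  For \<open>p = 2\<close> and \<open>p = 3\<close> the determinant is, up to a nonzero constant,
  \<open>(1 - z) (\<i> a (1 - z) + b (1 + z))\<close> with real \<open>a\<close> and \<open>b\<close> depending on \<open>\<rho>\<close> that do not vanish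
  simultaneously (\<open>det_symbol2\<close>, \<open>det_symbol3\<close>). Its zeros all lie on the unit circle
  (\<open>zero_on_unit_circle\<close>): besides \<open>z = 1\<close> there is only \<open>z = (\<i> a + b) / (\<i> a - b)\<close>, a quotient
  of two numbers of equal modulus.
\<close>
section \<open>Power series with polynomially bounded coefficients\<close>

definition poly_growth :: "complex fps \<Rightarrow> bool" where
  "poly_growth f \<longleftrightarrow> (\<exists>c k. \<forall>n. cmod (fps_nth f n) \<le> c * real (Suc n) ^ k)"

lemma poly_growthE:
  assumes "poly_growth f"
  obtains c k where "c \<ge> 0" "\<And>n. cmod (fps_nth f n) \<le> c * real (Suc n) ^ k"
proof -
  obtain c k where ck: "\<And>n. cmod (fps_nth f n) \<le> c * real (Suc n) ^ k"
    using assms unfolding poly_growth_def by blast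
  have "0 \<le> c" using order_trans[OF norm_ge_zero ck[of 0]] by simp
  then show thesis using that ck by blast
qed

text \<open>Finitely many series share one bound; the sum of the constants and the sum of the exponents
  serve for two of them.\<close>
lemma poly_growth_family:
  assumes "finite I" "\<And>i. i \<in> I \<Longrightarrow> poly_growth (f i)"
  shows "\<exists>c\<ge>0. \<exists>k. \<forall>i\<in>I. \<forall>n. cmod (fps_nth (f i) n) \<le> c * real (Suc n) ^ k"
  using assms
proof (induction I rule: finite_induct)
  case empty
  then show ?case by (intro exI[of _ 0]) auto
next
  case (insert a I)
  obtain c k where c: "c \<ge> 0" and ck: "\<And>i n. i \<in> I \<Longrightarrow> cmod (fps_nth (f i) n) \<le> c * real (Suc n) ^ k"
    using insert by blast
  obtain d l where d: "d \<ge> 0" and dl: "\<And>n. cmod (fps_nth (f a) n) \<le> d * real (Suc n) ^ l"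
    using insert by (meson insertI1 poly_growthE)
  have mono: "u * real (Suc n) ^ j \<le> (c + d) * real (Suc n) ^ (k + l)"
    if "u \<le> c + d" "j \<le> k + l" for u j n
    using that c d by (intro mult_mono power_increasing) auto
  have "cmod (fps_nth (f i) n) \<le> (c + d) * real (Suc n) ^ (k + l)" if "i \<in> insert a I" for i n
  proof (cases "i = a")
    case True
    then show ?thesis using order_trans[OF dl mono[of d l]] c by simp
  next
    case False
    then show ?thesis using that order_trans[OF ck mono[of c k]] d by simp
  qed
  then show ?case using c d by (intro exI[of _ "c + d"]) auto
qed

lemma poly_growth_bounded:
  assumes "\<And>n. cmod (fps_nth f n) \<le> c"
  shows "poly_growth f"
  unfolding poly_growth_def using assms by (intro exI[of _ c] exI[of _ 0]) simp

lemma poly_growth_fps_of_poly: "poly_growth (fps_of_poly p)"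
proof (rule poly_growth_bounded)
  fix n
  show "cmod (fps_nth (fps_of_poly p) n) \<le> (\<Sum>i\<le>degree p. cmod (coeff p i))"
  proof (cases "n \<le> degree p")
    case True
    then show ?thesis by (auto intro!: member_le_sum)
  next
    case False
    then show ?thesis by (simp add: coeff_eq_0 sum_nonneg)
  qed
qed

lemma poly_growth_const: "poly_growth (fps_const c)"
  using poly_growth_fps_of_poly[of "[:c:]"] by (simp add: fps_of_poly_const)

lemma poly_growth_add:
  assumes "poly_growth f" "poly_growth g"
  shows "poly_growth (f + g)"
proof -
  have "\<exists>c\<ge>0. \<exists>k. \<forall>h\<in>{f, g}. \<forall>n. cmod (fps_nth h n) \<le> c * real (Suc n) ^ k"
    by (rule poly_growth_family) (use assms in auto)
  then obtain c k where ck: "\<And>h n. h \<in> {f, g} \<Longrightarrow> cmod (fps_nth h n) \<le> c * real (Suc n) ^ k"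
    by blast
  have "cmod (fps_nth (f + g) n) \<le> (c + c) * real (Suc n) ^ k" for n
    using norm_triangle_mono[OF ck[of f n] ck[of g n]] by (simp add: ring_distribs)
  then show ?thesis unfolding poly_growth_def by blast
qed

text \<open>The convolution at \<open>n\<close> has \<open>n + 1\<close> terms, which costs one extra power of \<open>n + 1\<close>.\<close>
lemma poly_growth_mult:
  assumes "poly_growth f" "poly_growth g"
  shows "poly_growth (f * g)"
proof -
  obtain c k where c: "c \<ge> 0" and f: "\<And>n. cmod (fps_nth f n) \<le> c * real (Suc n) ^ k"
    using assms by (meson poly_growthE)
  obtain d l where d: "d \<ge> 0" and g: "\<And>n. cmod (fps_nth g n) \<le> d * real (Suc n) ^ l"
    using assms by (meson poly_growthE)
  have "cmod (fps_nth (f * g) n) \<le> (c * d) * real (Suc n) ^ (k + l + 1)" for n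
  proof -
    have "cmod (fps_nth (f * g) n) \<le> (\<Sum>i=0..n. cmod (fps_nth f i) * cmod (fps_nth g (n - i)))"
      unfolding fps_mult_nth by (rule order_trans[OF norm_sum]) (simp add: norm_mult)
    also have "\<dots> \<le> (\<Sum>i=0..n. (c * real (Suc n) ^ k) * (d * real (Suc n) ^ l))"
    proof (intro sum_mono mult_mono)
      fix i assume "i \<in> {0..n}"
      then show "cmod (fps_nth f i) \<le> c * real (Suc n) ^ k"
        using c by (intro order_trans[OF f] mult_left_mono power_mono) auto
      show "cmod (fps_nth g (n - i)) \<le> d * real (Suc n) ^ l"
        using d by (intro order_trans[OF g] mult_left_mono power_mono) auto
    qed (use c d in auto)
    also have "\<dots> = (c * d) * real (Suc n) ^ (k + l + 1)"
      by (simp add: power_add algebra_simps)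
    finally show ?thesis .
  qed
  then show ?thesis unfolding poly_growth_def by blast
qed

lemma poly_growth_sum:
  "(\<And>i. i \<in> I \<Longrightarrow> poly_growth (f i)) \<Longrightarrow> poly_growth (sum f I)"
  by (induction I rule: infinite_finite_induct)
    (auto intro: poly_growth_add poly_growth_const[of 0, simplified])

lemma poly_growth_prod:
  "(\<And>i. i \<in> I \<Longrightarrow> poly_growth (f i)) \<Longrightarrow> poly_growth (prod f I)"
  by (induction I rule: infinite_finite_induct)
    (auto intro: poly_growth_mult poly_growth_const[of 1, simplified])

lemma poly_growth_minus_one_power: "poly_growth ((-1) ^ n)"
  using poly_growth_const[of "(-1) ^ n"]
  by (metis fps_const_1_eq_1 fps_const_neg fps_const_power)

text \<open>Determinants and adjugates are polynomial expressions in the entries, so the closure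
  properties above pass on to them.\<close>
lemma poly_growth_det:
  assumes A: "A \<in> carrier_mat n n"
    and gr: "\<And>i j. i < n \<Longrightarrow> j < n \<Longrightarrow> poly_growth (A $$ (i, j))"
  shows "poly_growth (det A)"
  unfolding det_def'[OF A]
proof (intro poly_growth_sum poly_growth_mult poly_growth_prod)
  fix p assume p: "p \<in> {p. p permutes {0..<n}}"
  show "poly_growth (signof p)"
    using poly_growth_minus_one_power[of 0] poly_growth_minus_one_power[of 1]
    by (auto simp: sign_def)
  fix i assume "i \<in> {0..<n}"
  then show "poly_growth (A $$ (i, p i))"
    using p permutes_in_image[of p "{0..<n}" i] by (intro gr) auto
qed

lemma poly_growth_adj_mat:
  assumes A: "A \<in> carrier_mat n n"
    and gr: "\<And>i j. i < n \<Longrightarrow> j < n \<Longrightarrow> poly_growth (A $$ (i, j))"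
    and ij: "i < n" "j < n"
  shows "poly_growth (adj_mat A $$ (i, j))"
proof -
  have "poly_growth (det (mat_delete A j i))"
  proof (rule poly_growth_det)
    show "mat_delete A j i \<in> carrier_mat (n - 1) (n - 1)" using A by (auto simp: mat_delete_def)
    fix k l assume "k < n - 1" "l < n - 1"
    then show "poly_growth (mat_delete A j i $$ (k, l))"
      using A by (auto simp: mat_delete_def intro!: gr)
  qed
  then show ?thesis
    using A ij by (auto simp: adj_mat_def cofactor_def intro!: poly_growth_mult poly_growth_minus_one_power)
qed

lemma geometric_fps_inverse:
  fixes \<omega> :: complex
  shows "fps_of_poly [:1, -\<omega>:] * Abs_fps (\<lambda>n. \<omega> ^ n) = 1"
proof (rule fps_ext)
  fix n
  have "fps_of_poly [:1, -\<omega>:] * Abs_fps (\<lambda>n. \<omega> ^ n) =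
      Abs_fps (\<lambda>n. \<omega> ^ n) - fps_const \<omega> * (fps_X * Abs_fps (\<lambda>n. \<omega> ^ n))"
    by (simp add: fps_of_poly_pCons fps_of_poly_const algebra_simps flip: fps_const_neg)
  then show "fps_nth (fps_of_poly [:1, -\<omega>:] * Abs_fps (\<lambda>n. \<omega> ^ n)) n = fps_nth 1 n"
    by (cases n) auto
qed

lemma poly_growth_geometric:
  "cmod \<omega> \<le> 1 \<Longrightarrow> poly_growth (Abs_fps (\<lambda>n. \<omega> ^ n))"
  by (rule poly_growth_bounded[of _ 1]) (simp add: norm_power power_le_one)

section \<open>Block Toeplitz matrices and their symbols\<close>

text \<open>The block size \<open>p\<close> is read off the symbol. The guard \<open>J \<le> I\<close> on the block indices is what makes the
  matrix block lower triangular; natural number subtraction would otherwise send every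
  block above the diagonal to the constant coefficient.\<close>
definition toeplitz :: "nat \<Rightarrow> complex fps mat \<Rightarrow> complex mat" where
  "toeplitz N F = mat (dim_row F * N) (dim_row F * N)
     (\<lambda>(i, j). if j div dim_row F \<le> i div dim_row F
        then fps_nth (F $$ (i mod dim_row F, j mod dim_row F)) (i div dim_row F - j div dim_row F)
        else 0)"

lemma toeplitz_carrier [simp]:
  "F \<in> carrier_mat p p \<Longrightarrow> toeplitz N F \<in> carrier_mat (p * N) (p * N)"
  by (auto simp: toeplitz_def)

lemma toeplitz_index:
  assumes "F \<in> carrier_mat p p" "i < p * N" "j < p * N"
  shows "toeplitz N F $$ (i, j) =
    (if j div p \<le> i div p then fps_nth (F $$ (i mod p, j mod p)) (i div p - j div p) else 0)"
  using assms by (auto simp: toeplitz_def)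

lemma sum_blocks:
  fixes g :: "nat \<Rightarrow> 'a::comm_monoid_add"
  shows "sum g {..<p * N} = (\<Sum>K<N. \<Sum>t<p. g (K * p + t))"
proof -
  have "sum g {K * p..<K * p + p} = (\<Sum>t<p. g (K * p + t))" for K
    using sum.shift_bounds_nat_ivl[of g 0 "K * p" p]
    by (simp add: add.commute atLeast0LessThan)
  then show ?thesis
    using sum.nat_group[of g p N] by (simp add: mult.commute)
qed

text \<open>The product of the two lower triangular guards cuts the block sum over all \<open>K < N\<close> down to
  \<open>J \<le> K \<le> I\<close>. On this window it is a full Cauchy convolution, untouched by the truncation
  at \<open>N\<close>; this is why truncation is multiplicative.\<close>
lemma convolution_window:
  fixes f g :: "nat \<Rightarrow> complex"
  assumes "I < N"
  shows "(\<Sum>K<N. (if K \<le> I then f (I - K) else 0) * (if J \<le> K then g (K - J) else 0)) =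
    (if J \<le> I then \<Sum>k=0..I - J. f k * g (I - J - k) else 0)"
proof (cases "J \<le> I")
  case True
  have "(\<Sum>K<N. (if K \<le> I then f (I - K) else 0) * (if J \<le> K then g (K - J) else 0)) =
      (\<Sum>K\<in>{J..I}. f (I - K) * g (K - J))"
    using assms by (intro sum.mono_neutral_cong_right) auto
  also have "\<dots> = (\<Sum>k=0..I - J. f k * g (I - J - k))"
    by (rule sum.reindex_bij_witness[of _ "\<lambda>k. I - k" "\<lambda>K. I - K"]) (use True in auto)
  finally show ?thesis using True by simp
next
  case False
  then show ?thesis by (auto intro!: sum.neutral)
qed

text \<open>Entrywise, the inner summation index splits into a block number and a position inside the
  block; summing over the former gives the product of power series, summing over the latter
  the product of \<open>p \<times> p\<close> matrices.\<close>
lemma toeplitz_mult: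
  assumes F: "F \<in> carrier_mat p p" and G: "G \<in> carrier_mat p p"
  shows "toeplitz N (F * G) = toeplitz N F * toeplitz N G"
proof (rule eq_matI)
  fix i j
  assume "i < dim_row (toeplitz N F * toeplitz N G)" "j < dim_col (toeplitz N F * toeplitz N G)"
  then have i: "i < p * N" and j: "j < p * N"
    using F G by (auto simp: toeplitz_def)
  have p: "p > 0" using i by (cases p) auto
  define I J r s where "I = i div p" "J = j div p" "r = i mod p" "s = j mod p"
  have I: "I < N" and r: "r < p" and s: "s < p"
    using i j p by (auto simp: I_J_r_s_def less_mult_imp_div_less mult.commute)
  have idx: "K * p + t < p * N" if "K < N" "t < p" for K t
  proof -
    have "K * p + t < Suc K * p" using that by simp
    also have "\<dots> \<le> N * p" using that by (intro mult_le_mono1) simp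
    finally show ?thesis by (simp add: mult.commute)
  qed
  have "(toeplitz N F * toeplitz N G) $$ (i, j) =
      (\<Sum>m<p * N. toeplitz N F $$ (i, m) * toeplitz N G $$ (m, j))"
    using toeplitz_carrier[OF F, of N] toeplitz_carrier[OF G, of N] i j
    by (auto simp: scalar_prod_def atLeast0LessThan)
  also have "\<dots> = (\<Sum>K<N. \<Sum>t<p. (if K \<le> I then fps_nth (F $$ (r, t)) (I - K) else 0) *
      (if J \<le> K then fps_nth (G $$ (t, s)) (K - J) else 0))"
    unfolding sum_blocks
    by (intro sum.cong refl) (use i j p in \<open>simp add: toeplitz_index[OF F] toeplitz_index[OF G] idx I_J_r_s_def\<close>)
  also have "\<dots> = (\<Sum>t<p. if J \<le> I then fps_nth (F $$ (r, t) * G $$ (t, s)) (I - J) else 0)"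
    by (subst sum.swap) (simp add: convolution_window[OF I] fps_mult_nth cong: if_cong)
  also have "\<dots> = (if J \<le> I then fps_nth ((F * G) $$ (r, s)) (I - J) else 0)"
    using F G r s by (auto simp: scalar_prod_def atLeast0LessThan fps_sum_nth)
  also have "\<dots> = toeplitz N (F * G) $$ (i, j)"
    using toeplitz_index[of "F * G" p i N j] F G i j by (simp add: I_J_r_s_def)
  finally show "toeplitz N (F * G) $$ (i, j) = (toeplitz N F * toeplitz N G) $$ (i, j)" by simp
qed (use F G in \<open>auto simp: toeplitz_def\<close>)

lemma toeplitz_one: "toeplitz N (1\<^sub>m p) = 1\<^sub>m (p * N)"
proof (rule eq_matI)
  fix i j
  assume ij: "i < dim_row (1\<^sub>m (p * N) :: complex mat)" "j < dim_col (1\<^sub>m (p * N) :: complex mat)"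
  then have "p > 0" by (cases p) auto
  moreover have "i div p = j div p \<Longrightarrow> i mod p = j mod p \<Longrightarrow> i = j"
    by (metis div_mult_mod_eq)
  ultimately show "toeplitz N (1\<^sub>m p) $$ (i, j) = (1\<^sub>m (p * N) :: complex mat) $$ (i, j)"
    using ij by (auto simp: toeplitz_def)
qed (auto simp: toeplitz_def)

section \<open>Condition numbers\<close>

lemma euclidean_norm_le_sum: "euclidean_norm v \<le> (\<Sum>i<dim_vec v. cmod (v $ i))"
  unfolding euclidean_norm_def by (rule L2_set_le_sum) simp

text \<open>A crude estimate, in which each coordinate of \<open>v\<close> is bounded by 1 and the Euclidean norm of the
  image by the sum of moduli: only polynomial dependence on \<open>n\<close> matters below.\<close>
lemma euclidean_norm_mult_le:
  assumes A: "A \<in> carrier_mat n n" and b: "\<And>i j. i < n \<Longrightarrow> j < n \<Longrightarrow> cmod (A $$ (i, j)) \<le> b"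
    and v: "v \<in> carrier_vec n" "euclidean_norm v \<le> 1"
  shows "euclidean_norm (A *\<^sub>v v) \<le> b * real n ^ 2"
proof -
  have v1: "cmod (v $ j) \<le> 1" if "j < n" for j
    using member_le_L2_set[of "{..<n}" j "\<lambda>i. cmod (v $ i)"] that v
    by (simp add: euclidean_norm_def)
  have "cmod ((A *\<^sub>v v) $ i) \<le> real n * b" if i: "i < n" for i
  proof -
    have "cmod ((A *\<^sub>v v) $ i) = cmod (\<Sum>j<n. A $$ (i, j) * v $ j)"
      using A v i by (auto simp: scalar_prod_def atLeast0LessThan)
    also have "\<dots> \<le> (\<Sum>j<n. cmod (A $$ (i, j)) * cmod (v $ j))"
      by (rule order_trans[OF norm_sum]) (simp add: norm_mult)
    also have "\<dots> \<le> (\<Sum>j<n. b * 1)"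
      by (intro sum_mono mult_mono b v1) (use i order_trans[OF norm_ge_zero b[of i i]] in auto)
    finally show ?thesis by simp
  qed
  then have "(\<Sum>i<n. cmod ((A *\<^sub>v v) $ i)) \<le> (\<Sum>i<n. real n * b)"
    by (intro sum_mono) auto
  then show ?thesis
    using order_trans[OF euclidean_norm_le_sum[of "A *\<^sub>v v"]] A
    by (simp add: power2_eq_square algebra_simps)
qed

text \<open>Nonnegativity also rests on the entry bound, since the supremum dominates the value at \<open>v = 0\<close>
  only once its set is known to be bounded above.\<close>
lemma spectral_norm_entry_bound:
  assumes A: "A \<in> carrier_mat n n" and b: "\<And>i j. i < n \<Longrightarrow> j < n \<Longrightarrow> cmod (A $$ (i, j)) \<le> b"
  shows "0 \<le> spectral_norm A" and "spectral_norm A \<le> b * real n ^ 2"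
proof -
  let ?V = "{v \<in> carrier_vec (dim_col A). euclidean_norm v \<le> 1}"
  have z: "0\<^sub>v n \<in> ?V" using A by (auto simp: euclidean_norm_def L2_set_def)
  have le: "euclidean_norm (A *\<^sub>v v) \<le> b * real n ^ 2" if "v \<in> ?V" for v
    using that A by (intro euclidean_norm_mult_le[OF A b]) auto
  show "spectral_norm A \<le> b * real n ^ 2"
    unfolding spectral_norm_def using z le by (intro cSUP_least) auto
  have "0 \<le> euclidean_norm (A *\<^sub>v 0\<^sub>v n)" by (simp add: euclidean_norm_def)
  also have "\<dots> \<le> spectral_norm A"
    unfolding spectral_norm_def by (rule cSUP_upper[OF z]) (use le in \<open>auto intro!: bdd_aboveI\<close>)
  finally show "0 \<le> spectral_norm A" .
qed

text \<open>Exhibiting any right inverse suffices: over a field it is a two-sided inverse, and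
  Gauss-Jordan elimination must return it by uniqueness.\<close>
lemma condition_number_entry_bound:
  assumes A: "A \<in> carrier_mat n n" and B: "B \<in> carrier_mat n n" and AB: "A * B = 1\<^sub>m n"
    and a: "\<And>i j. i < n \<Longrightarrow> j < n \<Longrightarrow> cmod (A $$ (i, j)) \<le> a"
    and b: "\<And>i j. i < n \<Longrightarrow> j < n \<Longrightarrow> cmod (B $$ (i, j)) \<le> b"
  shows "condition_number A \<le> ereal (a * b * real n ^ 4)"
proof -
  have BA: "B * A = 1\<^sub>m n" by (rule mat_mult_left_right_inverse[OF A B AB])
  have "mat_inverse A = Some B"
  proof (cases "mat_inverse A")
    case None
    have "A \<in> Units (ring_mat TYPE(complex) n ())"
      unfolding Units_def using A B AB BA by (auto simp: ring_mat_simps)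
    then show ?thesis using mat_inverse(1)[OF A None, of "()"] by simp
  next
    case (Some B')
    from mat_inverse(2)[OF A Some] have B': "B' * A = 1\<^sub>m n" "B' \<in> carrier_mat n n" by auto
    have "B' = B' * (A * B)" using B' AB by simp
    also have "\<dots> = B" using assoc_mult_mat[OF B'(2) A B] B' B by simp
    finally show ?thesis using Some by simp
  qed
  moreover have "spectral_norm A * spectral_norm B \<le> (a * real n ^ 2) * (b * real n ^ 2)"
    using spectral_norm_entry_bound[OF A a] spectral_norm_entry_bound[OF B b]
    by (intro mult_mono) (auto intro: order_trans)
  ultimately show ?thesis
    by (simp add: condition_number_def algebra_simps flip: power_add)
qed

text \<open>The series \<open>h\<close> is the reciprocal of the determinant, so \<open>h\<close> times the adjugate is the inverse
  symbol. The entries of the matrix and of its inverse are coefficients of index less than \<open>N\<close>,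
  hence polynomially bounded in \<open>p N\<close>.\<close>
theorem condition_number_toeplitz_growth:
  assumes F: "F \<in> carrier_mat p p"
    and gr: "\<And>r s. r < p \<Longrightarrow> s < p \<Longrightarrow> poly_growth (F $$ (r, s))"
    and h: "det F * h = 1" "poly_growth h"
  shows "\<exists>c k. \<forall>N. condition_number (toeplitz N F) \<le> ereal (c * real (p * N) ^ k)"
proof -
  define G where "G = h \<cdot>\<^sub>m adj_mat F"
  have G: "G \<in> carrier_mat p p" using adj_mat(1)[OF F] by (simp add: G_def)
  have FG: "F * G = 1\<^sub>m p"
    unfolding G_def using mult_smult_distrib[OF F adj_mat(1)[OF F]] adj_mat(2)[OF F] h(1)
    by (auto intro!: eq_matI simp: mult.commute)
  have grG: "poly_growth (G $$ (r, s))" if "r < p" "s < p" for r s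
    using poly_growth_mult[OF h(2) poly_growth_adj_mat[OF F gr that]] adj_mat(1)[OF F] that
    by (auto simp: G_def)
  have entries: "\<exists>c k. \<forall>N i j. i < p * N \<longrightarrow> j < p * N \<longrightarrow>
      cmod (toeplitz N H $$ (i, j)) \<le> c * real (p * N) ^ k"
    if H: "H \<in> carrier_mat p p" and grH: "\<And>r s. r < p \<Longrightarrow> s < p \<Longrightarrow> poly_growth (H $$ (r, s))"
    for H
  proof -
    obtain c k where c: "c \<ge> 0" and
      ck: "\<And>r s n. r < p \<Longrightarrow> s < p \<Longrightarrow> cmod (fps_nth (H $$ (r, s)) n) \<le> c * real (Suc n) ^ k"
      using poly_growth_family[of "{..<p} \<times> {..<p}" "\<lambda>rs. H $$ rs"] grH by fastforce
    have "cmod (toeplitz N H $$ (i, j)) \<le> c * real (p * N) ^ k"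
      if ij: "i < p * N" "j < p * N" for N i j
    proof -
      have p: "p > 0" using ij by (cases p) auto
      have "i div p < N" using ij p by (simp add: less_mult_imp_div_less mult.commute)
      moreover have "N \<le> p * N" using p by simp
      ultimately have "Suc (i div p - j div p) \<le> p * N" by linarith
      then have "c * real (Suc (i div p - j div p)) ^ k \<le> c * real (p * N) ^ k"
        using c by (intro mult_left_mono power_mono) (auto simp del: of_nat_Suc of_nat_mult)
      then have "cmod (fps_nth (H $$ (i mod p, j mod p)) (i div p - j div p)) \<le> c * real (p * N) ^ k"
        using p by (intro order_trans[OF ck]) auto
      then show ?thesis using c by (simp add: toeplitz_index[OF H ij])
    qed
    then show ?thesis by blast
  qed
  obtain a k where ak: "\<And>N i j. i < p * N \<Longrightarrow> j < p * N \<Longrightarrow>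
      cmod (toeplitz N F $$ (i, j)) \<le> a * real (p * N) ^ k"
    using entries[OF F gr] by blast
  obtain b l where bl: "\<And>N i j. i < p * N \<Longrightarrow> j < p * N \<Longrightarrow>
      cmod (toeplitz N G $$ (i, j)) \<le> b * real (p * N) ^ l"
    using entries[OF G grG] by blast
  have "condition_number (toeplitz N F) \<le> ereal (a * b * real (p * N) ^ (k + l + 4))" for N
  proof -
    have "toeplitz N F * toeplitz N G = 1\<^sub>m (p * N)"
      by (simp add: FG toeplitz_one flip: toeplitz_mult[OF F G])
    from condition_number_entry_bound[OF toeplitz_carrier[OF F] toeplitz_carrier[OF G] this ak bl]
    show ?thesis by (simp add: power_add algebra_simps)
  qed
  then show ?thesis by blast
qed


text \<open>By induction on the degree, splitting off one linear factor at a time. Writing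
  \<open>X - z = -z (1 - X / z)\<close> with \<open>\<bar>1 / z\<bar> \<le> 1\<close>, its reciprocal is a multiple of a geometric
  series with bounded coefficients. Zeros on the unit circle are harmless: their multiplicities
  only raise the degree of growth.\<close>
lemma poly_inverse_fps_growth:
  fixes q :: "complex poly"
  assumes "\<And>z. poly q z = 0 \<Longrightarrow> 1 \<le> cmod z"
  shows "\<exists>h. fps_of_poly q * h = 1 \<and> poly_growth h"
  using assms
proof (induction "degree q" arbitrary: q)
  case 0
  then obtain c where q: "q = [:c:]" by (metis degree_eq_zeroE)
  have "c \<noteq> 0" using 0(2)[of 0] q by auto
  then show ?case
    by (intro exI[of _ "fps_const (1 / c)"]) (simp add: q fps_of_poly_const poly_growth_const)
next
  case (Suc d)
  have "\<not> constant (poly q)"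
    using Suc(2) by (simp add: constant_degree)
  then obtain z where z: "poly q z = 0"
    using fundamental_theorem_of_algebra by blast
  then obtain r where qr: "q = [:-z, 1:] * r" by (metis dvdE poly_eq_0_iff_dvd)
  have z1: "1 \<le> cmod z" using Suc(3)[OF z] .
  then have z0: "z \<noteq> 0" by auto
  have "r \<noteq> 0" using qr Suc(2) by auto
  then have "degree q = Suc (degree r)" unfolding qr by (subst degree_mult_eq) auto
  moreover have "1 \<le> cmod w" if "poly r w = 0" for w
    using Suc(3)[of w] that qr by simp
  ultimately obtain h where h: "fps_of_poly r * h = 1" "poly_growth h"
    using Suc(1)[of r] Suc(2) by auto
  define g where "g = fps_const (- 1 / z) * Abs_fps (\<lambda>n. (1 / z) ^ n)"
  have "[:-z, 1:] = [:-z:] * [:1, -(1 / z):]" using z0 by simp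
  then have "fps_of_poly [:-z, 1:] * g = fps_const (-z) * fps_const (- 1 / z) *
      (fps_of_poly [:1, -(1 / z):] * Abs_fps (\<lambda>n. (1 / z) ^ n))"
    unfolding g_def by (simp only: fps_of_poly_mult fps_of_poly_const mult_ac)
  also have "\<dots> = 1" using z0 by (simp only: geometric_fps_inverse) simp
  finally have "fps_of_poly q * (g * h) = 1"
    using h(1) unfolding qr fps_of_poly_mult by (metis mult.assoc mult.left_commute mult_1_right)
  moreover have "poly_growth (g * h)"
    unfolding g_def using z1 h(2)
    by (intro poly_growth_mult poly_growth_const poly_growth_geometric)
      (auto simp: norm_divide divide_le_eq)
  ultimately show ?case by blast
qed

theorem condition_number_toeplitz_fps_of_poly:
  assumes P: "P \<in> carrier_mat p p" and nz: "\<And>z. poly (det P) z = 0 \<Longrightarrow> 1 \<le> cmod z"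
  shows "\<exists>c k. \<forall>N. condition_number (toeplitz N (map_mat fps_of_poly P)) \<le> ereal (c * real (p * N) ^ k)"
proof -
  interpret comm_ring_hom "fps_of_poly :: complex poly \<Rightarrow> complex fps"
    by unfold_locales (simp_all add: fps_of_poly_add fps_of_poly_mult)
  obtain h where "det (map_mat fps_of_poly P) * h = 1" "poly_growth h"
    using poly_inverse_fps_growth[OF nz] by (auto simp: hom_det)
  then show ?thesis
    using P by (intro condition_number_toeplitz_growth) (auto intro: poly_growth_fps_of_poly)
qed

text \<open>The generating matrix polynomial of a sequence of blocks that is supported on the
  indices 0, 1, 2.\<close>
definition matrix_poly :: "nat \<Rightarrow> (int \<Rightarrow> complex mat) \<Rightarrow> complex poly mat" where
  "matrix_poly p A = mat p p (\<lambda>rs. [:A 0 $$ rs, A 1 $$ rs, A 2 $$ rs:])"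

lemma block_toeplitz_eq_toeplitz:
  assumes A: "\<And>k. A k \<in> carrier_mat p p" "\<And>k. k \<notin> {0, 1, 2} \<Longrightarrow> A k = 0\<^sub>m p p"
    and B: "\<And>k. B k \<in> carrier_mat p p" "\<And>k. k \<notin> {0, 1, 2} \<Longrightarrow> B k = 0\<^sub>m p p"
  shows "\<alpha> \<cdot>\<^sub>m block_toeplitz p N A - \<beta> \<cdot>\<^sub>m block_toeplitz p N B =
    toeplitz N (map_mat fps_of_poly (matrix_poly p (\<lambda>k. \<alpha> \<cdot>\<^sub>m A k - \<beta> \<cdot>\<^sub>m B k)))"
    (is "?S = toeplitz N ?F")
proof (rule eq_matI)
  have F: "?F \<in> carrier_mat p p" by (simp add: matrix_poly_def)
  fix i j assume "i < dim_row (toeplitz N ?F)" "j < dim_col (toeplitz N ?F)"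
  then have ij: "i < p * N" "j < p * N" using toeplitz_carrier[OF F, of N] by auto
  have p: "p > 0" using ij by (cases p) auto
  define I J r s where "I = i div p" "J = j div p" "r = i mod p" "s = j mod p"
  have rs: "r < p" "s < p" using p by (auto simp: I_J_r_s_def)
  have idx: "(\<alpha> \<cdot>\<^sub>m A k - \<beta> \<cdot>\<^sub>m B k) $$ (r, s) = \<alpha> * A k $$ (r, s) - \<beta> * B k $$ (r, s)" for k
    using A(1)[of k] B(1)[of k] rs by auto
  have "?S $$ (i, j) = \<alpha> * A (int I - int J) $$ (r, s) - \<beta> * B (int I - int J) $$ (r, s)"
    using ij by (simp add: block_toeplitz_def I_J_r_s_def)
  also have "\<dots> = (if J \<le> I then fps_nth (?F $$ (r, s)) (I - J) else 0)"
  proof (cases "J \<le> I")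
    case True
    define n where "n = I - J"
    have n: "int I - int J = int n" using True by (simp add: n_def)
    consider "n = 0" | "n = 1" | "n = 2" | m where "n = Suc (Suc (Suc m))"
      by (metis One_nat_def Suc_1 not0_implies_Suc)
    then show ?thesis
      unfolding n n_def[symmetric] using True rs
      by cases (auto simp: matrix_poly_def idx A(2) B(2) numeral_2_eq_2)
  next
    case False
    then show ?thesis using rs by (simp add: A(2) B(2))
  qed
  also have "\<dots> = toeplitz N ?F $$ (i, j)"
    by (simp add: toeplitz_index[OF F ij] I_J_r_s_def)
  finally show "?S $$ (i, j) = toeplitz N ?F $$ (i, j)" .
qed (auto simp: block_toeplitz_def toeplitz_def matrix_poly_def)

section \<open>The two determinants\<close>

lemma det_2x2:
  assumes A: "(A :: 'a::comm_ring_1 mat) \<in> carrier_mat 2 2"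
  shows "det A = A $$ (0, 0) * A $$ (1, 1) - A $$ (0, 1) * A $$ (1, 0)"
proof -
  have D: "det (mat_delete A i 0) = mat_delete A i 0 $$ (0, 0)" for i
    using A by (intro det_single) (auto simp: mat_delete_def)
  have "det A = A $$ (0, 0) * mat_delete A 0 0 $$ (0, 0) - A $$ (1, 0) * mat_delete A 1 0 $$ (0, 0)"
    by (subst laplace_expansion_column[OF A, of 0]) (simp_all add: cofactor_def D numeral_2_eq_2)
  then show ?thesis using A by (simp add: mat_delete_def mult.commute)
qed

lemma det_3x3:
  assumes A: "(A :: 'a::comm_ring_1 mat) \<in> carrier_mat 3 3"
  shows "det A =
    A $$ (0, 0) * (A $$ (1, 1) * A $$ (2, 2) - A $$ (1, 2) * A $$ (2, 1)) -
    A $$ (1, 0) * (A $$ (0, 1) * A $$ (2, 2) - A $$ (0, 2) * A $$ (2, 1)) +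
    A $$ (2, 0) * (A $$ (0, 1) * A $$ (1, 2) - A $$ (0, 2) * A $$ (1, 1))"
proof -
  have D: "det (mat_delete A i 0) =
      mat_delete A i 0 $$ (0, 0) * mat_delete A i 0 $$ (1, 1) -
      mat_delete A i 0 $$ (0, 1) * mat_delete A i 0 $$ (1, 0)" for i
    using A by (intro det_2x2) (auto simp: mat_delete_def)
  have "det A = A $$ (0, 0) * det (mat_delete A 0 0) - A $$ (1, 0) * det (mat_delete A 1 0) +
      A $$ (2, 0) * det (mat_delete A 2 0)"
    by (subst laplace_expansion_column[OF A, of 0]) (simp_all add: cofactor_def numeral_3_eq_3 numeral_2_eq_2)
  then show ?thesis using A unfolding D by (simp add: mat_delete_def numeral_2_eq_2)
qed

text \<open>For \<open>z \<noteq> 1\<close> the second factor says \<open>(\<i> a - b) z = \<i> a + b\<close>, and \<open>\<i> a - b\<close> and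
  \<open>\<i> a + b\<close> have the same modulus because \<open>a\<close> and \<open>b\<close> are real.\<close>
lemma zero_on_unit_circle:
  fixes z :: complex and a b :: real
  assumes "a \<noteq> 0 \<or> b \<noteq> 0"
    and "(1 - z) * (\<i> * of_real a * (1 - z) + of_real b * (1 + z)) = 0"
  shows "cmod z = 1"
proof (cases "z = 1")
  case False
  then have "\<i> * of_real a * (1 - z) + of_real b * (1 + z) = 0" using assms(2) by simp
  then have "Complex (-b) a * z = Complex b a"
    by (simp add: Complex_eq algebra_simps)
  then have "cmod (Complex (-b) a) * cmod z = cmod (Complex b a)"
    by (metis norm_mult)
  moreover have "cmod (Complex (-b) a) = cmod (Complex b a)" "cmod (Complex b a) \<noteq> 0"
    using assms(1) by (auto simp: cmod_def complex_eq_iff)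
  ultimately show ?thesis by simp
qed simp

definition symbol2 :: "real \<Rightarrow> complex poly mat" where
  "symbol2 \<rho> = matrix_poly 2 (\<lambda>k. \<i> \<cdot>\<^sub>m B2 k - of_real \<rho> \<cdot>\<^sub>m C2 k)"

definition symbol3 :: "real \<Rightarrow> complex poly mat" where
  "symbol3 \<rho> = matrix_poly 3 (\<lambda>k. \<i> \<cdot>\<^sub>m B3 k - of_real \<rho> \<cdot>\<^sub>m C3 k)"

lemma symbol_carrier: "symbol2 \<rho> \<in> carrier_mat 2 2" "symbol3 \<rho> \<in> carrier_mat 3 3"
  by (auto simp: symbol2_def symbol3_def matrix_poly_def)

lemma S2_eq: "S2 N \<rho> = toeplitz N (map_mat fps_of_poly (symbol2 \<rho>))"
  unfolding S2_def symbol2_def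
  by (rule block_toeplitz_eq_toeplitz) (auto simp: B2_def C2_def mat_of_rows_list_def)

lemma S3_eq: "S3 N \<rho> = toeplitz N (map_mat fps_of_poly (symbol3 \<rho>))"
  unfolding S3_def symbol3_def
  by (rule block_toeplitz_eq_toeplitz) (auto simp: B3_def C3_def mat_of_rows_list_def)

text \<open>Direct expansion. The factors 9 and 8000 clear the denominators; the 20 in \<open>8000 = 20\<^sup>3\<close> is the
  common denominator of the blocks for \<open>p = 3\<close>.\<close>
lemma det_symbol2:
  "9 * poly (det (symbol2 \<rho>)) z =
    \<i> * ((1 - z) * (\<i> * of_real (12 - \<rho>\<^sup>2) * (1 - z) + of_real (6 * \<rho>) * (1 + z)))"
  unfolding det_2x2[OF symbol_carrier(1)]
  by (simp add: symbol2_def matrix_poly_def B2_def C2_def mat_of_rows_list_def field_simps power2_eq_square)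

lemma det_symbol3:
  "8000 * poly (det (symbol3 \<rho>)) z =
    (1 - z) * (\<i> * of_real (1080 * (10 - \<rho>\<^sup>2)) * (1 - z) + of_real (90 * \<rho> * (60 - \<rho>\<^sup>2)) * (1 + z))"
  unfolding det_3x3[OF symbol_carrier(2)]
  by (simp add: symbol3_def matrix_poly_def B3_def C3_def mat_of_rows_list_def field_simps power2_eq_square)

theorem corollary5p13:
  fixes \<rho> :: real
  assumes "\<rho> > 0"
  shows "\<exists>\<nu>::real.
    (\<exists>c::real. \<forall>\<^sub>F N in sequentially.
       condition_number (S2 N \<rho>) \<le> ereal (c * real (2 * N) powr \<nu>)) \<and>
    (\<exists>c::real. \<forall>\<^sub>F N in sequentially.
       condition_number (S3 N \<rho>) \<le> ereal (c * real (3 * N) powr \<nu>))"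
proof -
  have "1 \<le> cmod z" if "poly (det (symbol2 \<rho>)) z = 0" for z
    using zero_on_unit_circle[of "12 - \<rho>\<^sup>2" "6 * \<rho>" z] det_symbol2[of \<rho> z] that assms by simp
  from condition_number_toeplitz_fps_of_poly[OF symbol_carrier(1)[of \<rho>] this]
  obtain c2 k2 where S2: "\<And>N. condition_number (S2 N \<rho>) \<le> ereal (c2 * real (2 * N) ^ k2)"
    unfolding S2_eq by blast
  \<comment> \<open>The two coefficients vanish for \<open>\<rho>\<^sup>2 = 10\<close> and \<open>\<rho>\<^sup>2 = 60\<close> respectively (\<open>\<rho> > 0\<close>), so never together.\<close>
  have "10 - \<rho>\<^sup>2 \<noteq> 0 \<or> \<rho> * (60 - \<rho>\<^sup>2) \<noteq> 0" using assms by auto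
  then have "1 \<le> cmod z" if "poly (det (symbol3 \<rho>)) z = 0" for z
    using zero_on_unit_circle[of "1080 * (10 - \<rho>\<^sup>2)" "90 * \<rho> * (60 - \<rho>\<^sup>2)" z]
      det_symbol3[of \<rho> z] that assms by simp
  from condition_number_toeplitz_fps_of_poly[OF symbol_carrier(2)[of \<rho>] this]
  obtain c3 k3 where S3: "\<And>N. condition_number (S3 N \<rho>) \<le> ereal (c3 * real (3 * N) ^ k3)"
    unfolding S3_eq by blast
  \<comment> \<open>One exponent has to serve both matrices; absolute values make the constants monotone in it.\<close>
  have raise: "c * real m ^ k \<le> \<bar>c\<bar> * real m powr real (k2 + k3)"
    if "m \<ge> 1" "k \<le> k2 + k3" for c m k
  proof -
    have "c * real m ^ k \<le> \<bar>c\<bar> * real m ^ (k2 + k3)"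
      using that by (intro mult_mono power_increasing) auto
    then show ?thesis using that by (simp add: powr_realpow del: of_nat_add)
  qed
  have "\<forall>\<^sub>F N in sequentially. condition_number (S2 N \<rho>) \<le> ereal (\<bar>c2\<bar> * real (2 * N) powr real (k2 + k3))"
    using eventually_ge_at_top[of 1]
  proof eventually_elim
    case (elim N)
    show ?case by (rule order_trans[OF S2]) (use raise[of "2 * N" k2 c2] elim in simp)
  qed
  moreover have "\<forall>\<^sub>F N in sequentially. condition_number (S3 N \<rho>) \<le> ereal (\<bar>c3\<bar> * real (3 * N) powr real (k2 + k3))"
    using eventually_ge_at_top[of 1]
  proof eventually_elim
    case (elim N)
    show ?case by (rule order_trans[OF S3]) (use raise[of "3 * N" k3 c3] elim in simp)
  qed
  ultimately show ?thesis by blast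
qed

end
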